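(* For every $n\ge1$, $\mathsf{D}_{\oplus}(\mathrm{MAJ}_n)=n-\mathsf{B}(n)+1$.
   Context: $\mathrm{MAJ}_n\colon\{0,1\}^n\to\{-1,1\}$ is defined by $\mathrm{MAJ}_n(x)=-1$ iff $\sum_{i=1}^n x_i\ge n/2$. $\mathsf{B}(n)$ is the number of ones in the binary representation of $n$. A parity decision tree is a rooted binary tree whose internal nodes are labeled by parities $\bigoplus_{i\in S}x_i$ ($S\subseteq[n]$), with two outgoing edges labeled by the possible values of the parity, and leaves labeled by $-1$ or $1$; on input $x$ one follows the edges consistent with $x$ and outputs the leaf label. $\mathsf{D}_{\oplus}(f)$ is the minimal depth of a parity decision tree computing $f$. *)

theory Defs
  imports Complex_Main "HOL-Library.FuncSet"
begin

definition cube :: "nat \<Rightarrow> (nat \<Rightarrow> nat) set" where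
  "cube n = {1..n} \<rightarrow>\<^sub>E {0, 1}"

definition MAJ :: "nat \<Rightarrow> (nat \<Rightarrow> nat) \<Rightarrow> int" where
  "MAJ n x = (if real (\<Sum>i=1..n. x i) \<ge> real n / 2 then - 1 else 1)"

definition binary_ones :: "nat \<Rightarrow> nat" where
  "binary_ones n = card {i. bit n i}"

text \<open>In \<open>Query S T0 T1\<close>, the subtrees \<open>T0\<close> and \<open>T1\<close> are the children along the edges
  labeled 0 and 1, the possible values of the parity of the variables in \<open>S\<close>.\<close>

datatype parity_tree = Leaf int | Query "nat set" parity_tree parity_tree

primrec parity_tree_on :: "nat \<Rightarrow> parity_tree \<Rightarrow> bool" where
  "parity_tree_on n (Leaf b) \<longleftrightarrow> b \<in> {- 1, 1}"
| "parity_tree_on n (Query S T0 T1) \<longleftrightarrow>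
     S \<subseteq> {1..n} \<and> parity_tree_on n T0 \<and> parity_tree_on n T1"

primrec tree_output :: "parity_tree \<Rightarrow> (nat \<Rightarrow> nat) \<Rightarrow> int" where
  "tree_output (Leaf b) x = b"
| "tree_output (Query S T0 T1) x =
     (if (\<Sum>i\<in>S. x i) mod 2 = 0 then tree_output T0 x else tree_output T1 x)"

primrec tree_depth :: "parity_tree \<Rightarrow> nat" where
  "tree_depth (Leaf b) = 0"
| "tree_depth (Query S T0 T1) = Suc (max (tree_depth T0) (tree_depth T1))"

definition computes :: "nat \<Rightarrow> parity_tree \<Rightarrow> ((nat \<Rightarrow> nat) \<Rightarrow> int) \<Rightarrow> bool" where
  "computes n T f \<longleftrightarrow> parity_tree_on n T \<and> (\<forall>x\<in>cube n. tree_output T x = f x)"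

text \<open>The minimum exists for every \<open>f\<close> mapping \<open>cube n\<close> to \<open>{- 1, 1}\<close>, since querying the
  variables one by one computes \<open>f\<close>.\<close>

definition D_parity :: "nat \<Rightarrow> ((nat \<Rightarrow> nat) \<Rightarrow> int) \<Rightarrow> nat" where
  "D_parity n f = (LEAST d. \<exists>T. computes n T f \<and> tree_depth T = d)"

end

theory Submission
  imports Defs "HOL-Computational_Algebra.Primes"
begin

text \<open>Lower bound: by induction on a tree \<open>T\<close> of depth \<open>d\<close>, the sum of any character over
  \<open>{x. T x = -1}\<close>, multiplied by \<open>2 ^ d\<close>, is divisible by \<open>2 ^ n\<close>: restricting to a value of a
  parity replaces a character by half the sum or difference of two characters. For majority and
  the character of a single variable, only the inputs where that variable is pivotal contribute,
  so the sum is a binomial coefficient, up to sign. By Legendre's formula it is divisible by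
  exactly the power \<open>2 ^ (B n - 1)\<close>, whence \<open>d \<ge> n - B n + 1\<close>.

  Upper bound: keep representatives of disjoint blocks of equal variables, the block sizes being
  powers of two. Comparing the representatives of two blocks of the same size either merges the
  blocks or shows that their contributions cancel. When the sizes are pairwise distinct, the
  variable representing the largest block decides the majority. If the blocks have total size
  \<open>N\<close>, then the number of blocks minus \<open>B N\<close> decreases with each comparison, because \<open>B\<close> is
  subadditive.\<close>

section \<open>Binary digits and Legendre's formula\<close>

lemma binary_ones_0 [simp]: "binary_ones 0 = 0"
  by (simp add: binary_ones_def)

lemma Collect_bit_double: "{i. bit (2 * n :: nat) i} = Suc ` {i. bit n i}"
proof -
  have "bit (2 * n) i \<longleftrightarrow> i \<in> Suc ` {i. bit n i}" for i
    by (cases i) (auto simp: bit_Suc bit_0)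
  then show ?thesis by blast
qed

lemma Collect_bit_Suc_double: "{i. bit (Suc (2 * n)) i} = insert 0 (Suc ` {i. bit n i})"
proof -
  have "bit (Suc (2 * n)) i \<longleftrightarrow> i \<in> insert 0 (Suc ` {i. bit n i})" for i
    by (cases i) (auto simp: bit_Suc bit_0)
  then show ?thesis by blast
qed

lemma finite_Collect_bit_nat: "finite {i. bit (n :: nat) i}"
  by (induction n rule: nat_bit_induct) (simp_all add: Collect_bit_double Collect_bit_Suc_double)

lemma binary_ones_double [simp]: "binary_ones (2 * n) = binary_ones n"
  by (simp add: binary_ones_def Collect_bit_double card_image)

lemma binary_ones_Suc_double [simp]: "binary_ones (Suc (2 * n)) = Suc (binary_ones n)"
  by (simp add: binary_ones_def Collect_bit_Suc_double card_image finite_Collect_bit_nat)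

lemma multiplicity_two_mult:
  fixes a b :: nat
  assumes "a > 0" "b > 0"
  shows "multiplicity 2 (a * b) = multiplicity 2 a + multiplicity 2 b"
  using assms by (intro prime_elem_multiplicity_mult_distrib) auto

text \<open>Incrementing clears the trailing ones of \<open>n\<close>, of which there are
  \<open>multiplicity 2 (Suc n)\<close>, and sets the next digit.\<close>

lemma binary_ones_Suc: "binary_ones (Suc n) + multiplicity 2 (Suc n) = Suc (binary_ones n)"
proof (induction n rule: nat_bit_induct)
  case zero
  show ?case using binary_ones_Suc_double[of 0] by simp
next
  case (even n)
  then show ?case by (simp add: not_dvd_imp_multiplicity_0)
next
  case (odd n)
  have eq: "Suc (Suc (2 * n)) = 2 * Suc n" by simp
  show ?case
    unfolding eq binary_ones_double binary_ones_Suc_double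
      multiplicity_two_mult[OF zero_less_numeral zero_less_Suc]
    using odd.IH by simp
qed

lemma multiplicity_two_fact: "multiplicity 2 (fact n :: nat) + binary_ones n = n"
proof (induction n)
  case (Suc n)
  have "multiplicity 2 (fact (Suc n) :: nat)
      = multiplicity 2 (Suc n) + multiplicity 2 (fact n :: nat)"
    by (simp only: fact_Suc of_nat_id multiplicity_two_mult fact_gt_zero zero_less_Suc)
  then show ?case
    using Suc.IH binary_ones_Suc[of n] by linarith
qed simp

text \<open>Kummer's theorem for the prime 2: the multiplicity counts the carries when
  \<open>a\<close> and \<open>b\<close> are added in binary.\<close>

lemma multiplicity_two_choose:
  "multiplicity 2 ((a + b) choose a) + binary_ones (a + b) = binary_ones a + binary_ones b"
proof -
  have "fact (a + b) = (fact a * fact b * ((a + b) choose a) :: nat)"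
    using binomial_fact_lemma[of a "a + b"] by (simp add: mult_ac)
  then have "multiplicity 2 (fact (a + b) :: nat) = multiplicity 2 (fact a :: nat)
      + multiplicity 2 (fact b :: nat) + multiplicity 2 ((a + b) choose a)"
    by (simp add: multiplicity_two_mult)
  then show ?thesis
    using multiplicity_two_fact[of a] multiplicity_two_fact[of b] multiplicity_two_fact[of "a + b"]
    by linarith
qed

lemma binary_ones_add_le: "binary_ones (a + b) \<le> binary_ones a + binary_ones b"
  using multiplicity_two_choose[of a b] by linarith

lemma binary_ones_power_two [simp]: "binary_ones (2 ^ k) = 1"
  by (induction k) (use binary_ones_Suc_double[of 0] in simp_all)

lemma binary_ones_sum_powers_le: "finite R \<Longrightarrow> binary_ones (\<Sum>r\<in>R. 2 ^ e r) \<le> card R"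
proof (induction R rule: finite_induct)
  case (insert r R)
  then show ?case
    using binary_ones_add_le[of "2 ^ e r" "\<Sum>r\<in>R. 2 ^ e r"] by simp
qed simp

text \<open>Majority takes the value -1 from \<open>(n + 1) div 2\<close> ones on, so this
  coefficient counts the settings of the other \<open>n - 1\<close> variables for which a given
  variable is pivotal.\<close>

lemma multiplicity_two_choose_pivotal:
  assumes "n \<ge> 1"
  shows "Suc (multiplicity 2 ((n - 1) choose ((n + 1) div 2 - 1))) = binary_ones n"
proof (cases "even n")
  case True
  then obtain m where "n = 2 * m" by blast
  with assms obtain k where n: "n = 2 * Suc k" by (cases m) auto
  have "multiplicity 2 (Suc (2 * k) choose k) + Suc (binary_ones k)
      = binary_ones k + binary_ones (Suc k)"
    using multiplicity_two_choose[of k "Suc k"] by (simp flip: mult_2)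
  then show ?thesis unfolding n binary_ones_double by simp
next
  case False
  then obtain m where n: "n = Suc (2 * m)" by (auto elim: oddE)
  then show ?thesis
    using multiplicity_two_choose[of m m] by (simp flip: mult_2)
qed

section \<open>The lower bound\<close>

text \<open>For \<open>\<epsilon> i \<in> {1, -1}\<close> this is the character of the set of those \<open>i\<close> with \<open>\<epsilon> i = -1\<close>.\<close>

definition character :: "nat \<Rightarrow> (nat \<Rightarrow> int) \<Rightarrow> (nat \<Rightarrow> nat) \<Rightarrow> int" where
  "character n \<epsilon> x = (\<Prod>i=1..n. \<epsilon> i ^ x i)"

lemma finite_cube [simp]: "finite (cube n)"
  by (simp add: cube_def finite_PiE)

text \<open>The sum factors over the coordinates into terms \<open>1 + \<epsilon> i\<close>, each 0
  or 2.\<close>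

lemma sum_character_dvd:
  assumes "\<And>i. \<epsilon> i \<in> {1, -1}"
  shows "2 ^ n dvd (\<Sum>x\<in>cube n. character n \<epsilon> x)"
proof -
  have "(\<Sum>x\<in>cube n. character n \<epsilon> x) = (\<Prod>i=1..n. \<Sum>v\<in>{0, 1}. \<epsilon> i ^ v)"
    unfolding cube_def character_def by (subst prod_sum_PiE) auto
  moreover have "(\<Prod>i=1..n. 2) dvd (\<Prod>i=1..n. \<Sum>v\<in>{0, 1}. \<epsilon> i ^ v)"
  proof (rule prod_dvd_prod)
    fix i show "2 dvd (\<Sum>v\<in>{0, 1}. \<epsilon> i ^ v)"
      using assms[of i] by auto
  qed
  ultimately show ?thesis by simp
qed

text \<open>The sign of a parity is itself a character, and characters multiply pointwise.\<close>

lemma character_mult_parity: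
  assumes "S \<subseteq> {1..n}"
  shows "(-1) ^ (\<Sum>i\<in>S. x i) * character n \<epsilon> x
      = character n (\<lambda>i. (if i \<in> S then -1 else 1) * \<epsilon> i) x"
proof -
  have "(-1 :: int) ^ (\<Sum>i\<in>S. x i) = (\<Prod>i\<in>S. (-1) ^ x i)"
    by (simp add: power_sum)
  also have "\<dots> = (\<Prod>i=1..n. if i \<in> S then (-1) ^ x i else 1)"
    using assms by (simp add: prod.If_cases Int_absorb1)
  also have "\<dots> = (\<Prod>i=1..n. (if i \<in> S then -1 else 1) ^ x i)"
    by (intro prod.cong) auto
  finally show ?thesis
    by (simp add: character_def power_mult_distrib prod.distrib)
qed

lemma tree_character_sum_dvd:
  assumes "parity_tree_on n T" "\<And>i. \<epsilon> i \<in> {1, -1}"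
  shows "2 ^ n dvd 2 ^ tree_depth T *
    (\<Sum>x\<in>cube n. if tree_output T x = -1 then character n \<epsilon> x else 0)"
  using assms
proof (induction T arbitrary: \<epsilon>)
  case (Leaf b)
  then show ?case using sum_character_dvd[of \<epsilon> n] by (cases "b = -1") simp_all
next
  case (Query S T0 T1)
  let ?A = "\<lambda>T \<epsilon>. \<Sum>x\<in>cube n. if tree_output T x = -1 then character n \<epsilon> x else 0"
  let ?d = "max (tree_depth T0) (tree_depth T1)"
  define \<epsilon>' where "\<epsilon>' = (\<lambda>i. (if i \<in> S then -1 else 1) * \<epsilon> i)"
  have \<epsilon>': "\<epsilon>' i \<in> {1, -1}" for i
    using Query.prems(2)[of i] by (auto simp: \<epsilon>'_def)
  have S: "S \<subseteq> {1..n}" using Query.prems(1) by simp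
  \<comment> \<open>The two characters agree where the parity of \<open>S\<close> is 0 and are
    opposite where it is 1, so the sum doubles the inputs sent to \<open>T0\<close> and the
    difference those sent to \<open>T1\<close>.\<close>
  have "2 * ?A (Query S T0 T1) \<epsilon> = ?A T0 \<epsilon> + ?A T0 \<epsilon>' + ?A T1 \<epsilon> - ?A T1 \<epsilon>'"
    unfolding sum_distrib_left sum.distrib[symmetric] sum_subtractf[symmetric]
  proof (rule sum.cong[OF refl])
    fix x
    have "character n \<epsilon>' x = (-1) ^ (\<Sum>i\<in>S. x i) * character n \<epsilon> x"
      unfolding \<epsilon>'_def by (rule character_mult_parity[OF S, symmetric])
    then show "2 * (if tree_output (Query S T0 T1) x = -1 then character n \<epsilon> x else 0)
        = (if tree_output T0 x = -1 then character n \<epsilon> x else 0)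
          + (if tree_output T0 x = -1 then character n \<epsilon>' x else 0)
          + (if tree_output T1 x = -1 then character n \<epsilon> x else 0)
          - (if tree_output T1 x = -1 then character n \<epsilon>' x else 0)"
      by (cases "even (\<Sum>i\<in>S. x i)") (auto simp: even_iff_mod_2_eq_zero)
  qed
  then have eq: "2 ^ tree_depth (Query S T0 T1) * ?A (Query S T0 T1) \<epsilon>
      = 2 ^ ?d * ?A T0 \<epsilon> + 2 ^ ?d * ?A T0 \<epsilon>' + 2 ^ ?d * ?A T1 \<epsilon> - 2 ^ ?d * ?A T1 \<epsilon>'"
    by (simp only: tree_depth.simps power_Suc2 mult.assoc distrib_left right_diff_distrib)
  \<comment> \<open>The subtrees may differ in depth; both divisibilities are lifted to the larger
    exponent.\<close>
  have raise: "2 ^ n dvd 2 ^ ?d * a" if "2 ^ n dvd 2 ^ k * a" "k \<le> ?d" for k and a :: int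
    using that by (meson dvd_trans dvd_refl le_imp_power_dvd mult_dvd_mono)
  have T: "parity_tree_on n T0" "parity_tree_on n T1" using Query.prems(1) by simp_all
  have "2 ^ n dvd 2 ^ ?d * ?A T0 \<epsilon>" "2 ^ n dvd 2 ^ ?d * ?A T0 \<epsilon>'"
    by (rule raise[OF Query.IH(1)[OF T(1)] max.cobounded1], fact)+
  moreover have "2 ^ n dvd 2 ^ ?d * ?A T1 \<epsilon>" "2 ^ n dvd 2 ^ ?d * ?A T1 \<epsilon>'"
    by (rule raise[OF Query.IH(2)[OF T(2)] max.cobounded2], fact)+
  ultimately show ?case unfolding eq by (intro dvd_add dvd_diff)
qed

lemma MAJ_eq_minus_one_iff: "MAJ n x = -1 \<longleftrightarrow> (n + 1) div 2 \<le> (\<Sum>i=1..n. x i)"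
proof -
  have "real n / 2 \<le> real (\<Sum>i=1..n. x i) \<longleftrightarrow> (n + 1) div 2 \<le> (\<Sum>i=1..n. x i)"
    by linarith
  then show ?thesis unfolding MAJ_def by simp
qed

lemma bij_betw_Pow_cube:
  "bij_betw (\<lambda>X. \<lambda>i\<in>{1..n}. of_bool (i \<in> X)) (Pow {1..n}) (cube n)"
proof (rule bij_betw_byWitness[where f' = "\<lambda>x. {i \<in> {1..n}. x i = 1}"])
  show "\<forall>x\<in>cube n. (\<lambda>i\<in>{1..n}. of_bool (i \<in> {i \<in> {1..n}. x i = 1})) = x"
  proof
    fix x assume x: "x \<in> cube n"
    show "(\<lambda>i\<in>{1..n}. of_bool (i \<in> {i \<in> {1..n}. x i = 1})) = x"
    proof
      fix i
      show "(\<lambda>i\<in>{1..n}. of_bool (i \<in> {i \<in> {1..n}. x i = 1})) i = x i"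
      proof (cases "i \<in> {1..n}")
        case True
        then have "x i \<in> {0, 1}" using x by (auto simp: cube_def)
        then show ?thesis using True by auto
      next
        case False
        then have "x i = undefined" using x unfolding cube_def by (rule PiE_arb[rotated])
        then show ?thesis using False by (simp only: restrict_apply if_False)
      qed
    qed
  qed
next
  show "\<forall>X\<in>Pow {1..n}. {i \<in> {1..n}. (\<lambda>i\<in>{1..n}. of_bool (i \<in> X)) i = (1 :: nat)} = X"
    by auto
next
  show "(\<lambda>X. \<lambda>i\<in>{1..n}. of_bool (i \<in> X)) ` Pow {1..n} \<subseteq> cube n"
    by (intro image_subsetI) (simp add: cube_def)
qed auto

text \<open>Inputs that differ only in variable \<open>n\<close> have opposite characters, so a pair
  cancels unless exactly one of its members has majority -1.\<close>

lemma MAJ_character_sum: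
  assumes "n \<ge> 1"
  shows "(\<Sum>x\<in>cube n. if MAJ n x = -1 then character n (\<lambda>i. if i = n then -1 else 1) x else 0)
    = - int ((n - 1) choose ((n + 1) div 2 - 1))"
proof -
  let ?g = "\<lambda>X. \<lambda>i\<in>{1..n}. of_bool (i \<in> X) :: nat"
  define c where "c = (n + 1) div 2"
  define m where "m = n - 1"
  have n: "n = Suc m" and c: "c \<ge> 1" using assms by (auto simp: c_def m_def)
  have sum: "(\<Sum>i=1..n. ?g X i) = card X" if "X \<subseteq> {1..n}" for X
    using that by (simp add: of_bool_def sum.If_cases Int_absorb1)
  have char: "character n (\<lambda>i. if i = n then -1 else 1) (?g X) = (if n \<in> X then -1 else 1)"
    for X
  proof -
    have "character n (\<lambda>i. if i = n then -1 else 1) (?g X)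
        = (\<Prod>i\<in>{1..n}. if i = n then (if n \<in> X then -1 else 1) else 1)"
      unfolding character_def by (intro prod.cong) auto
    then show ?thesis using assms by simp
  qed
  \<comment> \<open>The summand, transported from inputs to the sets of their ones.\<close>
  let ?h = "\<lambda>X. if c \<le> card X then (if n \<in> X then -1 else 1) else 0 :: int"
  have fin: "finite X" if "X \<in> Pow {1..m}" for X
    using that finite_subset by auto
  have inj: "inj_on (insert n) (Pow {1..m})"
    by (rule inj_onI) (metis PowD atLeastAtMost_iff insert_ident lessI n not_less subsetD)
  have "(\<Sum>x\<in>cube n. if MAJ n x = -1
        then character n (\<lambda>i. if i = n then -1 else 1) x else 0) = (\<Sum>X\<in>Pow {1..n}. ?h X)"
    unfolding sum.reindex_bij_betw[OF bij_betw_Pow_cube, symmetric]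
    by (intro sum.cong) (simp_all only: MAJ_eq_minus_one_iff sum char c_def PowD)
  also have "Pow {1..n} = Pow {1..m} \<union> insert n ` Pow {1..m}"
    by (simp add: n atLeastAtMostSuc_conv Pow_insert)
  also have "(\<Sum>X\<in>\<dots>. ?h X) = (\<Sum>X\<in>Pow {1..m}. ?h X) + (\<Sum>X\<in>insert n ` Pow {1..m}. ?h X)"
    by (rule sum.union_disjoint) (auto simp: n)
  also have "(\<Sum>X\<in>insert n ` Pow {1..m}. ?h X) = (\<Sum>X\<in>Pow {1..m}. ?h (insert n X))"
    by (rule sum.reindex_cong[OF inj refl refl])
  also have "(\<Sum>X\<in>Pow {1..m}. ?h X) + (\<Sum>X\<in>Pow {1..m}. ?h (insert n X))
      = (\<Sum>X\<in>Pow {1..m}. if card X = c - 1 then -1 else 0)"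
    unfolding sum.distrib[symmetric]
  proof (rule sum.cong[OF refl])
    fix X assume X: "X \<in> Pow {1..m}"
    then have nX: "n \<notin> X" by (auto simp: n)
    then have "card (insert n X) = Suc (card X)" using fin[OF X] by simp
    \<comment> \<open>Only \<open>insert n X\<close> reaches the threshold \<open>c\<close> when
      \<open>card X = c - 1\<close>; as \<open>c \<ge> 1\<close>, this subtraction is exact.\<close>
    then show "?h X + ?h (insert n X) = (if card X = c - 1 then -1 else 0)"
      using nX c by auto
  qed
  also have "\<dots> = - int (card {X. X \<subseteq> {1..m} \<and> card X = c - 1})"
    by (simp add: sum.If_cases Int_def)
  also have "\<dots> = - int (m choose (c - 1))"
    by (simp add: n_subsets)
  finally show ?thesis by (simp add: m_def c_def)
qed

lemma MAJ_depth_ge: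
  assumes "n \<ge> 1" "computes n T (MAJ n)"
  shows "n + 1 \<le> tree_depth T + binary_ones n"
proof -
  let ?\<epsilon> = "\<lambda>i. if i = n then -1 else 1 :: int"
  let ?C = "(n - 1) choose ((n + 1) div 2 - 1)"
  have "(\<Sum>x\<in>cube n. if tree_output T x = -1 then character n ?\<epsilon> x else 0) = - int ?C"
    unfolding MAJ_character_sum[OF assms(1), symmetric]
    using assms(2) by (intro sum.cong) (auto simp: computes_def)
  then have "2 ^ n dvd 2 ^ tree_depth T * (- int ?C)"
    using tree_character_sum_dvd[of n T ?\<epsilon>] assms(2) by (auto simp: computes_def)
  then have "int (2 ^ n) dvd int (2 ^ tree_depth T * ?C)" by simp
  then have "2 ^ n dvd 2 ^ tree_depth T * ?C" by (simp only: int_dvd_int_iff)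
  then have "n \<le> multiplicity 2 (2 ^ tree_depth T * ?C)"
    using assms(1) by (subst power_dvd_iff_le_multiplicity[symmetric]) auto
  also have "\<dots> = tree_depth T + multiplicity 2 ?C"
    using assms(1) by (subst multiplicity_two_mult) auto
  finally show ?thesis
    using multiplicity_two_choose_pivotal[OF assms(1)] by simp
qed

section \<open>The upper bound\<close>

text \<open>Distinct exponents below \<open>k\<close> contribute at most the geometric sum
  \<open>2 ^ k - 1\<close>.\<close>

lemma abs_sum_smaller_powers_less:
  fixes y :: "'a \<Rightarrow> int"
  assumes "finite R" "inj_on e R" "\<And>s. s \<in> R \<Longrightarrow> e s < k" "\<And>s. s \<in> R \<Longrightarrow> \<bar>y s\<bar> \<le> 1"
  shows "\<bar>\<Sum>s\<in>R. 2 ^ e s * y s\<bar> < 2 ^ k"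
proof -
  have "\<bar>\<Sum>s\<in>R. 2 ^ e s * y s\<bar> \<le> (\<Sum>s\<in>R. \<bar>2 ^ e s * y s\<bar>)"
    by (rule sum_abs)
  also have "\<dots> \<le> (\<Sum>s\<in>R. 2 ^ e s)"
    using assms(4) by (intro sum_mono) (simp add: abs_mult)
  also have "\<dots> = (\<Sum>j\<in>e ` R. 2 ^ j)"
    using assms(2) by (simp add: sum.reindex)
  also have "\<dots> \<le> (\<Sum>j<k. 2 ^ j)"
    using assms(3) by (intro sum_mono2) auto
  also have "\<dots> = 2 ^ k - 1"
    by (induction k) auto
  finally show ?thesis by simp
qed

text \<open>\<open>A\<close> plays the role of the inputs consistent with the answers so far, and
  \<open>2 ^ e r\<close> is the size of the block of \<open>r\<close>. The last assumption says that
  the surplus of ones over zeros is carried by the blocks in \<open>R\<close>; blocks that cancelled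
  have left \<open>R\<close>, so the total size may be below \<open>n\<close>.\<close>

lemma MAJ_tree_from_blocks:
  assumes "finite R" "R \<subseteq> {1..n}" "A \<subseteq> cube n"
    and "\<And>x. x \<in> A \<Longrightarrow>
      2 * int (\<Sum>i=1..n. x i) - int n = (\<Sum>r\<in>R. 2 ^ e r * (2 * int (x r) - 1))"
  shows "\<exists>T. parity_tree_on n T \<and> (\<forall>x\<in>A. tree_output T x = MAJ n x) \<and>
    tree_depth T + binary_ones (\<Sum>r\<in>R. 2 ^ e r) \<le> card R + 1"
  using assms
proof (induction "card R" arbitrary: R A e rule: less_induct)
  case less
  have maj: "MAJ n x = (if (\<Sum>r\<in>R. 2 ^ e r * (2 * int (x r) - 1)) \<ge> 0 then -1 else 1)"
    if "x \<in> A" for x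
  proof -
    have "real n / 2 \<le> real (\<Sum>i=1..n. x i) \<longleftrightarrow> 2 * int (\<Sum>i=1..n. x i) - int n \<ge> 0"
      by linarith
    then show ?thesis using less.prems(4)[OF that] by (simp add: MAJ_def)
  qed
  have bit: "x r \<in> {0, 1}" if "x \<in> A" "r \<in> R" for x r
    using that less.prems(2,3) by (auto simp: cube_def)
  show ?case
  proof (cases "inj_on e R")
    case inj: True
    show ?thesis
    proof (cases "R = {}")
      case True
      \<comment> \<open>Without blocks there is a tie, which majority resolves to -1.\<close>
      then show ?thesis
        using maj by (intro exI[of _ "Leaf (-1)"]) auto
    next
      case False
      define k where "k = Max (e ` R)"
      have "k \<in> e ` R" unfolding k_def using False less.prems(1) by (intro Max_in) auto
      then obtain r where r: "r \<in> R" "e r = k" by auto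
      have smaller: "e s < k" if "s \<in> R - {r}" for s
      proof -
        have "e s \<le> k" unfolding k_def using that less.prems(1) by (intro Max_ge) auto
        moreover have "e s \<noteq> e r" using inj that r(1) by (auto dest: inj_onD)
        ultimately show ?thesis using r(2) by simp
      qed
      \<comment> \<open>The largest block outweighs all others together, so \<open>x r\<close> fixes
        the sign of the sum.\<close>
      have "tree_output (Query {r} (Leaf 1) (Leaf (-1))) x = MAJ n x" if x: "x \<in> A" for x
      proof -
        have "(\<Sum>s\<in>R. 2 ^ e s * (2 * int (x s) - 1))
            = 2 ^ k * (2 * int (x r) - 1) + (\<Sum>s\<in>R - {r}. 2 ^ e s * (2 * int (x s) - 1))"
          using r less.prems(1) by (simp add: sum.remove)
        moreover have "\<bar>\<Sum>s\<in>R - {r}. 2 ^ e s * (2 * int (x s) - 1)\<bar> < 2 ^ k"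
        proof (rule abs_sum_smaller_powers_less)
          show "\<bar>2 * int (x s) - 1\<bar> \<le> 1" if "s \<in> R - {r}" for s
            using bit[OF x, of s] that by auto
        qed (use less.prems(1) smaller inj in \<open>auto intro: inj_on_subset\<close>)
        ultimately show ?thesis
          using bit[OF x r(1)] by (auto simp: maj[OF x])
      qed
      then show ?thesis
        using r(1) less.prems(2) binary_ones_sum_powers_le[OF less.prems(1), of e]
        by (intro exI[of _ "Query {r} (Leaf 1) (Leaf (-1))"]) auto
    qed
  next
    case False
    then obtain r s where rs: "r \<in> R" "s \<in> R" "r \<noteq> s" "e s = e r"
      by (auto simp: inj_on_def)
    define R0 where "R0 = R - {r, s}"
    \<comment> \<open>If \<open>x r = x s\<close>, the block of \<open>s\<close> is absorbed into
      that of \<open>r\<close>, whose size doubles.\<close>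
    define e1 where "e1 = e(r := Suc (e r))"
    have R: "R = insert r (insert s R0)" "r \<notin> R0" "s \<notin> R0" "finite R0"
      using rs less.prems(1) by (auto simp: R0_def)
    have card: "card R = card R0 + 2" using R rs(3) by simp
    have e1: "(\<Sum>q\<in>R0. 2 ^ e1 q * f q) = (\<Sum>q\<in>R0. 2 ^ e q * f q)" for f :: "nat \<Rightarrow> int"
      using R by (intro sum.cong) (auto simp: e1_def)
    have weight1: "(\<Sum>q\<in>insert r R0. 2 ^ e1 q :: nat) = (\<Sum>q\<in>R. 2 ^ e q)"
    proof -
      have "(\<Sum>q\<in>R0. 2 ^ e1 q :: nat) = (\<Sum>q\<in>R0. 2 ^ e q)"
        using R by (intro sum.cong) (auto simp: e1_def)
      then show ?thesis using R rs by (simp add: e1_def)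
    qed
    have weight0: "(\<Sum>q\<in>R. 2 ^ e q :: nat) = 2 ^ Suc (e r) + (\<Sum>q\<in>R0. 2 ^ e q)"
      using R rs by simp
    \<comment> \<open>Merging keeps the total size and loses one block, which pays for the
      query.\<close>
    have "\<exists>T. parity_tree_on n T \<and> (\<forall>x\<in>{x \<in> A. x r = x s}. tree_output T x = MAJ n x) \<and>
        tree_depth T + binary_ones (\<Sum>q\<in>insert r R0. 2 ^ e1 q) \<le> card (insert r R0) + 1"
    proof (rule less.hyps)
      fix x assume "x \<in> {x \<in> A. x r = x s}"
      then show "2 * int (\<Sum>i=1..n. x i) - int n
          = (\<Sum>q\<in>insert r R0. 2 ^ e1 q * (2 * int (x q) - 1))"
        using less.prems(4)[of x] R rs by (simp add: e1) (simp add: e1_def)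
    qed (use less.prems R rs card in auto)
    then obtain T0 where T0: "parity_tree_on n T0"
      "\<And>x. x \<in> A \<Longrightarrow> x r = x s \<Longrightarrow> tree_output T0 x = MAJ n x"
      "tree_depth T0 + binary_ones (\<Sum>q\<in>R. 2 ^ e q) \<le> card R0 + 2"
      unfolding weight1 using R by auto
    have "\<exists>T. parity_tree_on n T \<and> (\<forall>x\<in>{x \<in> A. x r \<noteq> x s}. tree_output T x = MAJ n x) \<and>
        tree_depth T + binary_ones (\<Sum>q\<in>R0. 2 ^ e q) \<le> card R0 + 1"
    proof (rule less.hyps)
      fix x assume x: "x \<in> {x \<in> A. x r \<noteq> x s}"
      then have "int (x r) + int (x s) = 1"
        using bit[of x r] bit[of x s] rs by auto
      then have "2 ^ e r * (2 * int (x r) - 1) + 2 ^ e r * (2 * int (x s) - 1) = 0"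
        by (simp add: distrib_left[symmetric])
      then show "2 * int (\<Sum>i=1..n. x i) - int n = (\<Sum>q\<in>R0. 2 ^ e q * (2 * int (x q) - 1))"
        using less.prems(4)[of x] x R rs by simp
    qed (use less.prems R rs card in auto)
    then obtain T1 where T1: "parity_tree_on n T1"
      "\<And>x. x \<in> A \<Longrightarrow> x r \<noteq> x s \<Longrightarrow> tree_output T1 x = MAJ n x"
      "tree_depth T1 + binary_ones (\<Sum>q\<in>R0. 2 ^ e q) \<le> card R0 + 1"
      by auto
    \<comment> \<open>Cancelling loses two blocks, but their joint size is a power of two, so the
      digit count drops by at most one; the other unit pays for the query.\<close>
    have "binary_ones (\<Sum>q\<in>R. 2 ^ e q) \<le> 1 + binary_ones (\<Sum>q\<in>R0. 2 ^ e q)"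
      unfolding weight0 using binary_ones_add_le[of "2 ^ Suc (e r)"]
      by (simp only: binary_ones_power_two)
    then have "tree_depth (Query {r, s} T0 T1) + binary_ones (\<Sum>q\<in>R. 2 ^ e q) \<le> card R + 1"
      using T0(3) T1(3) card by simp
    moreover have "tree_output (Query {r, s} T0 T1) x = MAJ n x" if "x \<in> A" for x
      using T0(2) T1(2) bit[OF that, of r] bit[OF that, of s] rs that
      by (cases "x r = x s") auto
    ultimately show ?thesis
      using T0(1) T1(1) rs less.prems(2) by (intro exI[of _ "Query {r, s} T0 T1"]) auto
  qed
qed

text \<open>At the start every variable is a block of size \<open>2 ^ 0\<close>, and the total size
  is \<open>n\<close>.\<close>

lemma MAJ_tree_exists:
  "\<exists>T. computes n T (MAJ n) \<and> tree_depth T + binary_ones n \<le> n + 1"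
proof -
  have "\<exists>T. parity_tree_on n T \<and> (\<forall>x\<in>cube n. tree_output T x = MAJ n x) \<and>
      tree_depth T + binary_ones (\<Sum>r\<in>{1..n}. 2 ^ (\<lambda>_. 0) r) \<le> card {1..n} + 1"
    by (rule MAJ_tree_from_blocks) (simp_all add: sum_subtractf sum_distrib_left)
  then show ?thesis by (simp add: computes_def)
qed

theorem theorem10:
  fixes n :: nat
  assumes "n \<ge> 1"
  shows "D_parity n (MAJ n) = n - binary_ones n + 1"
proof -
  \<comment> \<open>This makes the truncated subtraction in the claim exact.\<close>
  have "binary_ones n \<le> n" using multiplicity_two_fact[of n] by linarith
  then have eq: "n - binary_ones n + 1 + binary_ones n = n + 1" by simp
  obtain T where T: "computes n T (MAJ n)" "tree_depth T + binary_ones n \<le> n + 1"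
    using MAJ_tree_exists by blast
  then have "tree_depth T = n - binary_ones n + 1"
    using MAJ_depth_ge[OF assms T(1)] eq by linarith
  then show ?thesis
    unfolding D_parity_def
  proof (intro Least_equality)
    fix d assume "\<exists>T. computes n T (MAJ n) \<and> tree_depth T = d"
    then show "n - binary_ones n + 1 \<le> d"
      using MAJ_depth_ge[OF assms] eq by fastforce
  qed (use T(1) in blast)
qed

end
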